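(* For every integer $n \ge 0$, $|\mathfrak{D}^4_{2n}(1432)| = |\mathfrak{D}^4_{2n}(321)| = C_n$, where $C_n=\frac{1}{n+1}\binom{2n}{n}$ is the $n$-th Catalan number.
   Context: A permutation $\pi$ of $[N]=\{1,\dots,N\}$ is written as $\pi(1)\pi(2)\cdots\pi(N)$. A Dumont permutation of the fourth kind (Dumont-4 permutation) of size $2n$ is a permutation $\pi$ of $[2n]$ in which all deficiencies are even values at even positions: for all $1\le i\le 2n$, if $\pi(i)<i$ then both $i$ and $\pi(i)$ are even. The set of these is $\mathfrak{D}^4_{2n}$ (for $n=0$ it consists of the empty permutation). A permutation $\pi$ of $[N]$ contains a pattern $\tau\in S_k$ if there are indices $i_1<\dots<i_k$ such that for all $a,b$, $\pi(i_a)<\pi(i_b)$ if and only if $\tau(a)<\tau(b)$; otherwise $\pi$ avoids $\tau$. $\mathfrak{D}^4_{2n}(\tau)$ denotes the set of permutations in $\mathfrak{D}^4_{2n}$ avoiding $\tau$. *)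

theory Defs
  imports Complex_Main "HOL-Combinatorics.Permutations"
begin

text \<open>
  A permutation of \<open>[N]\<close> is a function with \<open>p permutes {1..N}\<close>, so it is the identity
  outside \<open>{1..N}\<close>; in particular \<open>id\<close> is the only permutation of \<open>[0]\<close>.
\<close>

definition dumont4 :: "nat \<Rightarrow> (nat \<Rightarrow> nat) set" where
  "dumont4 n = {p. p permutes {1..2 * n} \<and>
     (\<forall>i\<in>{1..2 * n}. p i < i \<longrightarrow> even i \<and> even (p i))}"

text \<open>
  A pattern of length \<open>k\<close> is given by its one-line notation as a list, so its \<open>a\<close>-th entry is
  \<open>\<tau> ! (a - 1)\<close>; the increasing positions are accordingly indexed by \<open>{..<k}\<close>.
\<close>

definition contains_pattern :: "nat \<Rightarrow> (nat \<Rightarrow> nat) \<Rightarrow> nat list \<Rightarrow> bool" where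
  "contains_pattern N p \<tau> \<longleftrightarrow>
     (\<exists>pos :: nat \<Rightarrow> nat. strict_mono_on {..<length \<tau>} pos \<and>
        pos ` {..<length \<tau>} \<subseteq> {1..N} \<and>
        (\<forall>a<length \<tau>. \<forall>b<length \<tau>. p (pos a) < p (pos b) \<longleftrightarrow> \<tau> ! a < \<tau> ! b))"

definition dumont4_avoiding :: "nat \<Rightarrow> nat list \<Rightarrow> (nat \<Rightarrow> nat) set" where
  "dumont4_avoiding n \<tau> = {p \<in> dumont4 n. \<not> contains_pattern (2 * n) p \<tau>}"

definition catalan :: "nat \<Rightarrow> real" where
  "catalan n = 1 / (real n + 1) * real ((2 * n) choose n)"

end

theory Submission
  imports Defs "HOL-Library.Infinite_Set"
begin

text \<open>
  Both patterns are avoided by the same Dumont-4 permutations. Since the value 1 is odd, it is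
  not the value of a deficiency and therefore stands first; a leading minimum is the 1 of a 1432
  over every 321 that follows, and is itself in no 321. So \<open>dumont4_avoiding_1432_eq_321\<close> is an
  equality of sets.

  A permutation avoids 321 exactly if it is increasing on the set of its deficiencies and on the
  remaining positions (\<open>avoids_321_iff\<close>). It is then determined by the positions D and the values
  V of its deficiencies, and a pair of equinumerous subsets of \<open>{1..N}\<close> arises in this way exactly
  if the i-th smallest element of V is less than the i-th smallest element of D for all i
  (\<open>bij_betw_deficiency_pair\<close>). In these terms the Dumont-4 condition only says that
  all elements of D and V are even. Halving them turns the pairs for \<open>2 * n\<close> into arbitrary
  pairs for \<open>n\<close> (\<open>card_even_ballot_pairs\<close>).

  Finally, such pairs correspond to nonnegative paths of \<open>2 * n\<close> unit steps from height 0 back to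
  height 0, of which there are Catalan many. They are counted by induction on \<open>n\<close>, which needs
  arbitrary final heights: \<open>card_ballot_pairs_Suc\<close> is the recurrence and \<open>card_ballot_pairs\<close> the
  resulting difference of binomial coefficients.
\<close>

section \<open>The patterns 321 and 1432\<close>

lemma contains_321_iff:
  "contains_pattern N p [3, 2, 1] \<longleftrightarrow>
     (\<exists>i j k. i \<in> {1..N} \<and> j \<in> {1..N} \<and> k \<in> {1..N} \<and> i < j \<and> j < k \<and> p k < p j \<and> p j < p i)"
  (is "?L \<longleftrightarrow> ?R")
proof
  assume ?L
  then obtain pos :: "nat \<Rightarrow> nat" where mono: "strict_mono_on {..<3} pos" and ran: "pos ` {..<3} \<subseteq> {1..N}"
    and ord: "\<forall>a<3. \<forall>b<3. p (pos a) < p (pos b) \<longleftrightarrow> [3, 2, 1 :: nat] ! a < [3, 2, 1] ! b"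
    by (auto simp: contains_pattern_def numeral_3_eq_3)
  have "pos 0 < pos 1" "pos 1 < pos 2"
    using mono by (auto simp: strict_mono_on_def)
  moreover have "p (pos 2) < p (pos 1)" "p (pos 1) < p (pos 0)"
    using ord by auto
  moreover have "pos 0 \<in> {1..N}" "pos 1 \<in> {1..N}" "pos 2 \<in> {1..N}"
    using ran by (auto simp: image_subset_iff)
  ultimately show ?R by blast
next
  assume ?R
  then obtain i j k where "i \<in> {1..N}" "j \<in> {1..N}" "k \<in> {1..N}" "i < j" "j < k" "p k < p j" "p j < p i"
    by blast
  then show ?L
    unfolding contains_pattern_def
    by (intro exI[of _ "(!) [i, j, k]"])
      (auto simp: strict_mono_on_def less_Suc_eq)
qed

lemma contains_1432_iff:
  "contains_pattern N p [1, 4, 3, 2] \<longleftrightarrow>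
     (\<exists>h i j k. h \<in> {1..N} \<and> i \<in> {1..N} \<and> j \<in> {1..N} \<and> k \<in> {1..N} \<and> h < i \<and> i < j \<and> j < k \<and>
        p h < p k \<and> p k < p j \<and> p j < p i)"
  (is "?L \<longleftrightarrow> ?R")
proof
  assume ?L
  then obtain pos :: "nat \<Rightarrow> nat" where mono: "strict_mono_on {..<4} pos" and ran: "pos ` {..<4} \<subseteq> {1..N}"
    and ord: "\<forall>a<4. \<forall>b<4. p (pos a) < p (pos b) \<longleftrightarrow> [1, 4, 3, 2 :: nat] ! a < [1, 4, 3, 2] ! b"
    by (auto simp: contains_pattern_def numeral_eq_Suc)
  have "pos 0 < pos 1" "pos 1 < pos 2" "pos 2 < pos 3"
    using mono by (auto simp: strict_mono_on_def)
  moreover have "p (pos 0) < p (pos 3)" "p (pos 3) < p (pos 2)" "p (pos 2) < p (pos 1)"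
    using ord by (auto simp: nth_Cons')
  moreover have "pos 0 \<in> {1..N}" "pos 1 \<in> {1..N}" "pos 2 \<in> {1..N}" "pos 3 \<in> {1..N}"
    using ran by (auto simp: image_subset_iff)
  ultimately show ?R by blast
next
  assume ?R
  then obtain h i j k where "h \<in> {1..N}" "i \<in> {1..N}" "j \<in> {1..N}" "k \<in> {1..N}"
    "h < i" "i < j" "j < k" "p h < p k" "p k < p j" "p j < p i"
    by blast
  then show ?L
    unfolding contains_pattern_def
    by (intro exI[of _ "(!) [h, i, j, k]"])
      (auto simp: strict_mono_on_def less_Suc_eq)
qed

text \<open>
  The odd value 1 cannot be the value of a deficiency, so it sits at position 1. This entry is
  too small to take part in a 321, and it precedes and undercuts every 321, completing it to a 1432.
\<close>

lemma dumont4_avoiding_1432_eq_321: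
  "dumont4_avoiding n [1, 4, 3, 2] = dumont4_avoiding n [3, 2, 1]"
proof -
  have "contains_pattern (2 * n) p [1, 4, 3, 2] \<longleftrightarrow> contains_pattern (2 * n) p [3, 2, 1]"
    if p: "p \<in> dumont4 n" for p
  proof
    assume "contains_pattern (2 * n) p [1, 4, 3, 2]"
    then show "contains_pattern (2 * n) p [3, 2, 1]"
      unfolding contains_1432_iff contains_321_iff by blast
  next
    assume "contains_pattern (2 * n) p [3, 2, 1]"
    then obtain i j k where ijk: "i \<in> {1..2 * n}" "j \<in> {1..2 * n}" "k \<in> {1..2 * n}"
        "i < j" "j < k" "p k < p j" "p j < p i"
      unfolding contains_321_iff by blast
    from p have perm: "p permutes {1..2 * n}"
      and def_even: "\<And>l. l \<in> {1..2 * n} \<Longrightarrow> p l < l \<Longrightarrow> even (p l)"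
      by (auto simp: dumont4_def)
    have one: "1 \<in> {1..2 * n}" using ijk by auto
    then obtain l where l: "l \<in> {1..2 * n}" "p l = 1"
      using permutes_image[OF perm] by (metis imageE)
    then have "l = 1" using def_even[of l] by (cases "l = 1") auto
    with l have p1: "p 1 = 1" by simp
    have "1 \<le> p k" using permutes_in_image[OF perm, of k] ijk by auto
    moreover have "p k \<noteq> 1" using permutes_inj[OF perm] p1 ijk by (metis atLeastAtMost_iff injD not_less)
    ultimately have "p 1 < p k" using p1 by simp
    moreover have "1 < i" using \<open>p k < p j\<close> \<open>p j < p i\<close> \<open>1 \<le> p k\<close> p1 ijk by (cases "i = 1") auto
    ultimately show "contains_pattern (2 * n) p [1, 4, 3, 2]"
      unfolding contains_1432_iff using one ijk by blast
  qed
  then show ?thesis by (auto simp: dumont4_avoiding_def)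
qed

section \<open>321-avoiding permutations as pairs of increasing sequences\<close>

lemma permutes_later_smaller:
  fixes p :: "nat \<Rightarrow> nat"
  assumes perm: "p permutes {1..N}" and "i \<in> {1..N}" "j \<in> {1..N}" "i < j" "p j < p i" "j \<le> p j"
  shows "\<exists>k\<in>{1..N}. j < k \<and> p k < p j"
proof (rule ccontr)
  assume none: "\<not> ?thesis"
  have "{1..<p j} \<subseteq> p ` ({1..<j} - {i})"
  proof
    fix v assume v: "v \<in> {1..<p j}"
    have "p j \<le> N" using permutes_in_image[OF perm, of j] assms by auto
    then have "v \<in> {1..N}" using v by simp
    then have "v \<in> p ` {1..N}" using permutes_image[OF perm] by simp
    then obtain k where k: "k \<in> {1..N}" "v = p k" by blast
    then have "k \<le> j" using none v by (auto simp: not_less)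
    moreover have "k \<noteq> j" "k \<noteq> i" using k v assms by auto
    ultimately show "v \<in> p ` ({1..<j} - {i})" using k by auto
  qed
  then have "card {1..<p j} \<le> card ({1..<j} - {i})"
    by (meson card_image_le card_mono finite_Diff finite_atLeastLessThan finite_imageI le_trans)
  then show False using assms by (auto simp: card_Diff_subset)
qed

lemma permutes_earlier_larger:
  fixes p :: "nat \<Rightarrow> nat"
  assumes perm: "p permutes {1..N}" and "i \<in> {1..N}" "j \<in> {1..N}" "i < j" "p j < p i" "p i < i"
  shows "\<exists>k\<in>{1..N}. k < i \<and> p i < p k"
proof (rule ccontr)
  assume none: "\<not> ?thesis"
  have inj: "inj p" by (rule permutes_inj[OF perm])
  have pj: "p j \<in> {1..N}" using permutes_in_image[OF perm, of j] assms by auto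
  have "p ` {1..<i} \<subseteq> {1..<p i} - {p j}"
  proof
    fix v assume "v \<in> p ` {1..<i}"
    then obtain k where k: "k \<in> {1..<i}" "v = p k" by blast
    then have kN: "k \<in> {1..N}" using \<open>i \<in> {1..N}\<close> by simp
    then have "v \<le> p i" using none k kN by (meson atLeastLessThan_iff not_less)
    moreover have "v \<noteq> p i" "v \<noteq> p j" using k \<open>i < j\<close> by (auto simp: inj_eq[OF inj])
    moreover have "1 \<le> v" using permutes_in_image[OF perm, of k] kN k by auto
    ultimately show "v \<in> {1..<p i} - {p j}" by auto
  qed
  then have "card (p ` {1..<i}) \<le> card ({1..<p i} - {p j})"
    by (intro card_mono) auto
  moreover have "card (p ` {1..<i}) = i - 1"
    using inj by (simp add: card_image inj_on_subset)
  ultimately show False using assms pj by (auto simp: card_Diff_subset)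
qed

definition deficiencies :: "nat \<Rightarrow> (nat \<Rightarrow> nat) \<Rightarrow> nat set" where
  "deficiencies N p = {i \<in> {1..N}. p i < i}"

text \<open>
  An inversion whose right entry is not a deficiency leaves too few earlier positions for the
  values below that entry, so one of them comes later and completes a 321; dually, an inversion
  whose left entry is a deficiency has a larger entry before it. Conversely, two of the three
  entries of a 321 lie in the same one of the two classes.
\<close>

lemma avoids_321_iff:
  assumes perm: "p permutes {1..N}"
  shows "\<not> contains_pattern N p [3, 2, 1] \<longleftrightarrow>
    strict_mono_on (deficiencies N p) p \<and> strict_mono_on ({1..N} - deficiencies N p) p"
proof
  assume avoid: "\<not> contains_pattern N p [3, 2, 1]"
  have no: False if "i \<in> {1..N}" "j \<in> {1..N}" "i < j" "p j < p i" "p i < i \<or> j \<le> p j" for i j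
    using that(5)
  proof
    assume "p i < i"
    with permutes_earlier_larger[OF perm that(1-4)] that avoid show False
      unfolding contains_321_iff by blast
  next
    assume "j \<le> p j"
    with permutes_later_smaller[OF perm that(1-4)] that avoid show False
      unfolding contains_321_iff by blast
  qed
  have ne: "p i \<noteq> p j" if "i < j" for i j
    using permutes_inj[OF perm] that by (metis injD less_irrefl)
  show "strict_mono_on (deficiencies N p) p \<and> strict_mono_on ({1..N} - deficiencies N p) p"
  proof (intro conjI strict_mono_onI)
    fix i j assume "i \<in> deficiencies N p" "j \<in> deficiencies N p" "i < j"
    then show "p i < p j" using no[of i j] ne[of i j] by (force simp: deficiencies_def)
  next
    fix i j assume "i \<in> {1..N} - deficiencies N p" "j \<in> {1..N} - deficiencies N p" "i < j"
    then show "p i < p j" using no[of i j] ne[of i j] by (force simp: deficiencies_def)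
  qed
next
  assume mono: "strict_mono_on (deficiencies N p) p \<and> strict_mono_on ({1..N} - deficiencies N p) p"
  let ?D = "deficiencies N p"
  have cross: "i \<in> ?D \<longleftrightarrow> j \<notin> ?D" if "i \<in> {1..N}" "j \<in> {1..N}" "i < j" "p j < p i" for i j
    using mono that unfolding strict_mono_on_def by (meson DiffI less_asym)
  show "\<not> contains_pattern N p [3, 2, 1]"
    unfolding contains_321_iff by (metis cross less_trans)
qed

section \<open>Ballot pairs\<close>

text \<open>
  For equinumerous sets (\<open>h = 0\<close>) the inequality says that the i-th smallest element of \<open>V\<close> is
  smaller than the i-th smallest element of \<open>D\<close>, for every i. In general, read for each
  m in turn first a step down or up according to whether m is in \<open>D\<close>, then a step up or down
  according to whether m is in \<open>V\<close>: the pair becomes a path with \<open>2 * n\<close> steps that stays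
  nonnegative and ends at height \<open>2 * h\<close>.
\<close>

definition ballot_pairs :: "nat \<Rightarrow> nat \<Rightarrow> (nat set \<times> nat set) set" where
  "ballot_pairs n h = {(D, V). D \<subseteq> {1..n} \<and> V \<subseteq> {1..n} \<and> card V = card D + h \<and>
     (\<forall>m. card (D \<inter> {..m}) \<le> card (V \<inter> {..<m}))}"

lemma finite_ballot_pairs: "finite (ballot_pairs n h)"
  by (rule finite_subset[of _ "Pow {1..n} \<times> Pow {1..n}"]) (auto simp: ballot_pairs_def)

lemma strict_mono_on_card_below:
  fixes f :: "nat \<Rightarrow> nat"
  assumes "strict_mono_on A f" "a \<in> A"
  shows "card (f ` A \<inter> {..f a}) = card (A \<inter> {..a})"
proof -
  have "f ` A \<inter> {..f a} = f ` (A \<inter> {..a})"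
  proof (intro equalityI subsetI)
    fix y assume "y \<in> f ` A \<inter> {..f a}"
    then obtain x where x: "x \<in> A" "y = f x" "f x \<le> f a" by auto
    then have "x \<le> a" using strict_mono_onD[OF assms(1,2), of x] by (meson leD not_less)
    then show "y \<in> f ` (A \<inter> {..a})" using x by blast
  qed (use assms in \<open>auto simp: strict_mono_on_leD\<close>)
  moreover have "inj_on f (A \<inter> {..a})"
    using strict_mono_on_imp_inj_on[OF assms(1)] by (rule inj_on_subset) auto
  ultimately show ?thesis by (simp add: card_image)
qed

lemma strict_mono_on_unique:
  fixes f g :: "nat \<Rightarrow> nat"
  assumes "finite A" "strict_mono_on A f" "strict_mono_on A g" "f ` A = g ` A" "a \<in> A"
  shows "f a = g a"
proof -
  have le: "f a \<le> g a" if "strict_mono_on A f" "strict_mono_on A g" "f ` A = g ` A" for f g :: "nat \<Rightarrow> nat"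
  proof (rule ccontr)
    assume "\<not> f a \<le> g a"
    then have "f ` A \<inter> {..g a} \<subset> f ` A \<inter> {..f a}" using \<open>a \<in> A\<close> by auto
    then have "card (f ` A \<inter> {..g a}) < card (f ` A \<inter> {..f a})"
      using \<open>finite A\<close> by (intro psubset_card_mono) auto
    then show False
      using strict_mono_on_card_below[OF that(1) \<open>a \<in> A\<close>] strict_mono_on_card_below[OF that(2) \<open>a \<in> A\<close>] that(3)
      by simp
  qed
  show ?thesis using le[of f g] le[of g f] assms by simp
qed

lemma ex_strict_mono_on_image:
  fixes A B :: "nat set"
  assumes "finite A" "finite B" "card A = card B"
  obtains f where "strict_mono_on A f" "f ` A = B"
proof -
  obtain a where a: "bij_betw a {..<card A} A" "strict_mono_on {..<card A} a"
    by (rule ex_bij_betw_strict_mono_card[OF \<open>finite A\<close>])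
  obtain b where b: "bij_betw b {..<card A} B" "strict_mono_on {..<card A} b"
    by (rule ex_bij_betw_strict_mono_card[OF \<open>finite B\<close>, folded assms(3)])
  let ?f = "b \<circ> inv_into {..<card A} a"
  have inv: "inv_into {..<card A} a x \<in> {..<card A}" "a (inv_into {..<card A} a x) = x" if "x \<in> A" for x
    using a(1) that by (metis bij_betw_def inv_into_into, metis bij_betw_def f_inv_into_f)
  have "strict_mono_on A ?f"
  proof (rule strict_mono_onI)
    fix x y assume xy: "x \<in> A" "y \<in> A" "x < y"
    have "inv_into {..<card A} a x < inv_into {..<card A} a y"
      using inv[OF xy(1)] inv[OF xy(2)] a(2) xy(3)
      by (metis linorder_not_less strict_mono_on_leD)
    then show "?f x < ?f y"
      using inv xy b(2) by (simp add: strict_mono_on_def)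
  qed
  moreover have "?f ` A = B"
    using bij_betw_trans[OF bij_betw_inv_into[OF a(1)] b(1)] by (simp add: bij_betw_def)
  ultimately show ?thesis by (rule that)
qed

definition deficiency_pair :: "nat \<Rightarrow> (nat \<Rightarrow> nat) \<Rightarrow> nat set \<times> nat set" where
  "deficiency_pair N p = (deficiencies N p, p ` deficiencies N p)"

text \<open>The deficiencies up to m have distinct values, all smaller than m.\<close>

lemma deficiency_pair_in_ballot_pairs:
  assumes perm: "p permutes {1..N}"
  shows "deficiency_pair N p \<in> ballot_pairs N 0"
proof -
  let ?D = "deficiencies N p"
  have sub: "?D \<subseteq> {1..N}" by (auto simp: deficiencies_def)
  have inj: "inj_on p A" for A using permutes_inj[OF perm] by (rule inj_on_subset) auto
  have "card (?D \<inter> {..m}) \<le> card (p ` ?D \<inter> {..<m})" for m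
  proof (rule card_inj_on_le[OF inj])
    show "p ` (?D \<inter> {..m}) \<subseteq> p ` ?D \<inter> {..<m}" by (auto simp: deficiencies_def)
    show "finite (p ` ?D \<inter> {..<m})" by simp
  qed
  moreover have "p ` ?D \<subseteq> {1..N}" using sub permutes_image[OF perm] by blast
  ultimately show ?thesis
    using sub by (simp add: deficiency_pair_def ballot_pairs_def card_image[OF inj])
qed

text \<open>
  An increasing map on a finite set is determined by its image, and the images of the
  deficiencies and of the remaining positions are complementary.
\<close>

lemma deficiency_pair_inj:
  assumes p: "p permutes {1..N}" "\<not> contains_pattern N p [3, 2, 1]"
    and q: "q permutes {1..N}" "\<not> contains_pattern N q [3, 2, 1]"
    and eq: "deficiency_pair N p = deficiency_pair N q"
  shows "p = q"
proof
  fix i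
  let ?D = "deficiencies N p" and ?W = "{1..N} - deficiencies N p"
  have D: "deficiencies N q = ?D" and V: "p ` ?D = q ` ?D"
    using eq by (auto simp: deficiency_pair_def)
  note mp = p(2)[unfolded avoids_321_iff[OF p(1)]]
    and mq = q(2)[unfolded avoids_321_iff[OF q(1)] D]
  have "p ` ?W = q ` ?W"
    using V permutes_image[OF p(1)] permutes_image[OF q(1)] permutes_inj[OF p(1)] permutes_inj[OF q(1)]
    by (simp add: image_set_diff)
  moreover have "finite ?D" by (simp add: deficiencies_def)
  ultimately have "i \<in> ?D \<Longrightarrow> p i = q i" "i \<in> ?W \<Longrightarrow> p i = q i"
    using mp mq V strict_mono_on_unique[of ?D p q i] strict_mono_on_unique[of ?W p q i] by auto
  moreover have "p i = q i" if "i \<notin> {1..N}"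
    using that p(1) q(1) by (simp add: permutes_def)
  ultimately show "p i = q i" by blast
qed

text \<open>
  The permutation with a given ballot pair maps \<open>D\<close> to \<open>V\<close> and the complement of \<open>D\<close> to that of
  \<open>V\<close>, increasingly. Comparing how many elements lie below a position with how many lie below
  its image, the ballot inequality makes every element of \<open>D\<close> a deficiency and, passing to
  complements, no other position.
\<close>

lemma deficiency_pair_surj:
  assumes "(D, V) \<in> ballot_pairs N 0"
  shows "\<exists>p. p permutes {1..N} \<and> \<not> contains_pattern N p [3, 2, 1] \<and> deficiency_pair N p = (D, V)"
proof -
  have D: "D \<subseteq> {1..N}" and V: "V \<subseteq> {1..N}" and card: "card D = card V"
    and ballot: "\<And>m. card (D \<inter> {..m}) \<le> card (V \<inter> {..<m})"
    using assms by (auto simp: ballot_pairs_def)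
  have fin: "finite D" "finite V" using D V by (auto intro: finite_subset)
  define W W' where "W = {1..N} - D" and "W' = {1..N} - V"
  have "card W = card W'" unfolding W_def W'_def using D V card fin by (simp add: card_Diff_subset)
  then obtain g where g: "strict_mono_on W g" "g ` W = W'"
    using ex_strict_mono_on_image[of W W'] by (auto simp: W_def W'_def)
  obtain f where f: "strict_mono_on D f" "f ` D = V"
    using ex_strict_mono_on_image fin card by metis
  have f_less: "f i < i" if "i \<in> D" for i
  proof (rule ccontr)
    assume "\<not> f i < i"
    then have "V \<inter> {..<i} \<subset> V \<inter> {..f i}" using f(2) that by auto
    then have "card (V \<inter> {..<i}) < card (V \<inter> {..f i})"
      using fin by (intro psubset_card_mono) auto
    also have "\<dots> = card (D \<inter> {..i})"
      using strict_mono_on_card_below[OF f(1) that] f(2) by simp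
    finally show False using ballot[of i] by simp
  qed
  have g_ge: "i \<le> g i" if "i \<in> W" for i
  proof (rule ccontr)
    assume less: "\<not> i \<le> g i"
    define m where "m = g i"
    have "m \<in> W'" using g(2) that by (auto simp: m_def)
    then have mN: "m \<le> N" by (auto simp: W'_def)
    \<comment> \<open>Among \<open>{1..m}\<close>, the sets \<open>D\<close> and \<open>W\<close> are complementary, and so are \<open>V\<close> and \<open>W'\<close>.\<close>
    have compl: "card (X \<inter> {..m}) + card (({1..N} - X) \<inter> {..m}) = m" if "X \<subseteq> {1..N}" for X
    proof -
      have "card (X \<inter> {..m}) + card (({1..N} - X) \<inter> {..m}) = card ((X \<inter> {..m}) \<union> (({1..N} - X) \<inter> {..m}))"
        using that by (intro card_Un_disjoint[symmetric]) auto
      also have "(X \<inter> {..m}) \<union> (({1..N} - X) \<inter> {..m}) = {1..m}" using that mN by auto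
      finally show ?thesis by simp
    qed
    have "W \<inter> {..m} \<subset> W \<inter> {..i}" using less that by (auto simp: m_def)
    then have "card (W \<inter> {..m}) < card (W \<inter> {..i})" by (intro psubset_card_mono) auto
    also have "\<dots> = card (W' \<inter> {..m})"
      using strict_mono_on_card_below[OF g(1) that] g(2) by (simp add: m_def)
    finally have "card (V \<inter> {..m}) < card (D \<inter> {..m})"
      using compl[OF D] compl[OF V] by (simp add: W_def W'_def)
    moreover have "card (V \<inter> {..<m}) \<le> card (V \<inter> {..m})" by (rule card_mono) auto
    ultimately show False using ballot[of m] by simp
  qed
  define p where "p i = (if i \<in> D then f i else if i \<in> W then g i else i)" for i
  have pD: "p i = f i" if "i \<in> D" for i using that by (simp add: p_def)
  have pW: "p i = g i" if "i \<in> W" for i using that by (simp add: p_def W_def)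
  have "p ` D = V" using f(2) pD by simp
  moreover have "p ` W = W'" using g(2) pW by simp
  moreover have "D \<union> W = {1..N}" "V \<union> W' = {1..N}" using D V by (auto simp: W_def W'_def)
  ultimately have "p ` {1..N} = {1..N}" by (metis image_Un)
  then have "bij_betw p {1..N} {1..N}"
    by (simp add: bij_betw_def eq_card_imp_inj_on)
  then have perm: "p permutes {1..N}"
    by (rule bij_imp_permutes) (use D in \<open>auto simp: p_def W_def\<close>)
  have def: "deficiencies N p = D"
  proof -
    have "p i < i \<longleftrightarrow> i \<in> D" if "i \<in> {1..N}" for i
      using f_less[of i] g_ge[of i] that pD[of i] pW[of i] by (cases "i \<in> D") (auto simp: W_def)
    then show ?thesis using D by (auto simp: deficiencies_def)
  qed
  have "strict_mono_on D p" "strict_mono_on W p"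
    using f(1) g(1) pD pW by (auto simp: strict_mono_on_def)
  then have "\<not> contains_pattern N p [3, 2, 1]"
    unfolding avoids_321_iff[OF perm] def W_def by blast
  with perm def \<open>p ` D = V\<close> show ?thesis by (auto simp: deficiency_pair_def)
qed

lemma bij_betw_deficiency_pair:
  "bij_betw (deficiency_pair N) {p. p permutes {1..N} \<and> \<not> contains_pattern N p [3, 2, 1]} (ballot_pairs N 0)"
  unfolding bij_betw_def
proof
  show "inj_on (deficiency_pair N) {p. p permutes {1..N} \<and> \<not> contains_pattern N p [3, 2, 1]}"
    by (auto intro!: inj_onI intro: deficiency_pair_inj)
  show "deficiency_pair N ` {p. p permutes {1..N} \<and> \<not> contains_pattern N p [3, 2, 1]} = ballot_pairs N 0"
    using deficiency_pair_surj by (force simp: deficiency_pair_in_ballot_pairs)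
qed

section \<open>Dumont-4 permutations and even ballot pairs\<close>

definition even_pair :: "nat set \<times> nat set \<Rightarrow> bool" where
  "even_pair = (\<lambda>(D, V). (\<forall>x\<in>D. even x) \<and> (\<forall>x\<in>V. even x))"

definition double_pair :: "nat set \<times> nat set \<Rightarrow> nat set \<times> nat set" where
  "double_pair = (\<lambda>(D, V). ((*) 2 ` D, (*) 2 ` V))"

lemma card_dumont4_avoiding_321_eq_even_pairs:
  "card (dumont4_avoiding n [3, 2, 1]) = card {x \<in> ballot_pairs (2 * n) 0. even_pair x}"
proof -
  let ?A = "{p. p permutes {1..2 * n} \<and> \<not> contains_pattern (2 * n) p [3, 2, 1]}"
  have eq: "dumont4_avoiding n [3, 2, 1] = {p \<in> ?A. even_pair (deficiency_pair (2 * n) p)}"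
    by (auto simp: dumont4_avoiding_def dumont4_def even_pair_def deficiency_pair_def deficiencies_def)
  have "bij_betw (deficiency_pair (2 * n)) {p \<in> ?A. even_pair (deficiency_pair (2 * n) p)}
      {x \<in> ballot_pairs (2 * n) 0. even_pair x}"
    by (rule bij_betw_Collect[OF bij_betw_deficiency_pair]) simp
  then show ?thesis unfolding eq by (rule bij_betw_same_card)
qed

lemma card_double_atMost:
  fixes X :: "nat set" shows "card ((*) 2 ` X \<inter> {..m}) = card (X \<inter> {..m div 2})"
proof -
  have "(*) 2 ` X \<inter> {..m} = (*) 2 ` (X \<inter> {..m div 2})" by auto
  then show ?thesis by (simp add: card_image inj_on_def)
qed

lemma card_double_lessThan:
  fixes X :: "nat set" shows "card ((*) 2 ` X \<inter> {..<m}) = card (X \<inter> {..<Suc m div 2})"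
proof -
  have "(*) 2 ` X \<inter> {..<m} = (*) 2 ` (X \<inter> {..<Suc m div 2})" by auto
  then show ?thesis by (simp add: card_image inj_on_def)
qed

lemma double_pair_in_ballot_pairs_iff:
  "double_pair x \<in> ballot_pairs (2 * n) h \<longleftrightarrow> x \<in> ballot_pairs n h"
proof -
  obtain D V where x: "x = (D, V)" by (cases x)
  have sub: "(*) 2 ` X \<subseteq> {1..2 * n} \<longleftrightarrow> X \<subseteq> {1..n}" for X :: "nat set" by fastforce
  have card: "card ((*) 2 ` X) = card X" for X :: "nat set" by (simp add: card_image inj_on_def)
  have "(\<forall>m. card (D \<inter> {..m div 2}) \<le> card (V \<inter> {..<Suc m div 2})) \<longleftrightarrow>
      (\<forall>m. card (D \<inter> {..m}) \<le> card (V \<inter> {..<m}))" (is "?L \<longleftrightarrow> ?R")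
  proof
    assume L: ?L
    show ?R
    proof
      fix m show "card (D \<inter> {..m}) \<le> card (V \<inter> {..<m})" using L[rule_format, of "2 * m"] by simp
    qed
  next
    assume R: ?R
    \<comment> \<open>For odd \<open>m\<close> the right-hand side counts one more candidate than for \<open>m - 1\<close>.\<close>
    show ?L
    proof
      fix m
      have "card (D \<inter> {..m div 2}) \<le> card (V \<inter> {..<m div 2})" using R by blast
      also have "\<dots> \<le> card (V \<inter> {..<Suc m div 2})" by (rule card_mono) auto
      finally show "card (D \<inter> {..m div 2}) \<le> card (V \<inter> {..<Suc m div 2})" .
    qed
  qed
  then show ?thesis
    by (simp only: x double_pair_def ballot_pairs_def mem_Collect_eq prod.case sub card
        card_double_atMost card_double_lessThan)
qed

lemma card_even_ballot_pairs:
  "card {x \<in> ballot_pairs (2 * n) h. even_pair x} = card (ballot_pairs n h)"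
proof -
  have halve: "\<exists>Y. X = (*) 2 ` Y" if "\<forall>x\<in>X. even x" for X :: "nat set"
    by (rule exI[of _ "(\<lambda>x. x div 2) ` X"]) (use that in \<open>force simp: image_image\<close>)
  have "{x \<in> ballot_pairs (2 * n) h. even_pair x} = double_pair ` ballot_pairs n h" (is "?E = _")
  proof
    show "?E \<subseteq> double_pair ` ballot_pairs n h"
    proof
      fix x assume x: "x \<in> ?E"
      obtain D V where DV: "x = (D, V)" by (cases x)
      then obtain D' V' where "D = (*) 2 ` D'" "V = (*) 2 ` V'"
        using x halve[of D] halve[of V] by (auto simp: even_pair_def)
      then have eq: "x = double_pair (D', V')" by (simp add: DV double_pair_def)
      then have "(D', V') \<in> ballot_pairs n h"
        using x double_pair_in_ballot_pairs_iff by blast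
      with eq show "x \<in> double_pair ` ballot_pairs n h" by blast
    qed
    show "double_pair ` ballot_pairs n h \<subseteq> ?E"
      using double_pair_in_ballot_pairs_iff[of _ n h]
      by (auto simp: even_pair_def) (auto simp: double_pair_def)
  qed
  moreover have "inj double_pair"
    by (auto simp: inj_def double_pair_def inj_image_eq_iff)
  ultimately show ?thesis by (simp add: card_image inj_on_subset)
qed

section \<open>Counting ballot pairs\<close>

definition add_top :: "nat \<Rightarrow> bool \<Rightarrow> bool \<Rightarrow> nat set \<times> nat set \<Rightarrow> nat set \<times> nat set" where
  "add_top k d v = (\<lambda>(D, V). (if d then insert k D else D, if v then insert k V else V))"

text \<open>
  When \<open>n + 1\<close> is added, the ballot inequality at \<open>m = n + 1\<close> is the only new condition, and it fails only
  for \<open>d\<close> true, from height 0, the height being \<open>card V - card D\<close>.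
\<close>

lemma add_top_in_ballot_pairs_iff:
  assumes D: "D \<subseteq> {1..n}" and V: "V \<subseteq> {1..n}"
  shows "add_top (Suc n) d v (D, V) \<in> ballot_pairs (Suc n) h \<longleftrightarrow>
    (\<exists>g. (D, V) \<in> ballot_pairs n g \<and> g + of_bool v = h + of_bool d \<and> (d \<longrightarrow> g > 0))"
proof -
  let ?D = "if d then insert (Suc n) D else D" and ?V = "if v then insert (Suc n) V else V"
  have fin: "finite D" "finite V" using D V by (auto intro: finite_subset)
  have top: "Suc n \<notin> D" "Suc n \<notin> V" using D V by auto
  have cards: "card ?D = card D + of_bool d" "card ?V = card V + of_bool v"
    using fin top by auto
  have below: "?D \<inter> {..m} = D \<inter> {..m}" "?V \<inter> {..<m} = V \<inter> {..<m}" if "m \<le> n" for m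
    using that by auto
  have at: "?D \<inter> {..Suc n} = ?D" "?V \<inter> {..<Suc n} = V"
    using D V by (auto split: if_splits)
  have above: "?D \<inter> {..m} = ?D" "?V \<inter> {..<m} = ?V" if "m > Suc n" for m
    using D V that by (auto split: if_splits)
  have above0: "D \<inter> {..m} = D" "V \<inter> {..<m} = V" if "m > n" for m
    using D V that by auto
  have split: "(\<forall>m. card (?D \<inter> {..m}) \<le> card (?V \<inter> {..<m})) \<longleftrightarrow>
      (\<forall>m\<le>n. card (D \<inter> {..m}) \<le> card (V \<inter> {..<m})) \<and> card ?D \<le> card V"
    (is "?L \<longleftrightarrow> ?R")
  proof
    assume L: ?L
    show ?R using L[rule_format, of "Suc n"] L below unfolding at by metis
  next
    assume R: ?R
    show ?L
    proof
      fix m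
      consider "m \<le> n" | "m = Suc n" | "m > Suc n" by linarith
      then show "card (?D \<inter> {..m}) \<le> card (?V \<inter> {..<m})"
      proof cases
        case 1 then show ?thesis using R by (simp only: below)
      next
        case 2 then show ?thesis using R by (simp only: at)
      next
        case 3 show ?thesis unfolding above[OF 3] using R cards by linarith
      qed
    qed
  qed
  have split0: "(\<forall>m. card (D \<inter> {..m}) \<le> card (V \<inter> {..<m})) \<longleftrightarrow>
      (\<forall>m\<le>n. card (D \<inter> {..m}) \<le> card (V \<inter> {..<m})) \<and> card D \<le> card V"
    using above0 by (metis lessI not_le)
  have sub: "?D \<subseteq> {1..Suc n}" "?V \<subseteq> {1..Suc n}" using D V by auto
  have "add_top (Suc n) d v (D, V) \<in> ballot_pairs (Suc n) h \<longleftrightarrow>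
      card V + of_bool v = card D + of_bool d + h \<and>
      (\<forall>m\<le>n. card (D \<inter> {..m}) \<le> card (V \<inter> {..<m})) \<and> card D + of_bool d \<le> card V"
    using sub by (simp only: add_top_def ballot_pairs_def split cards mem_Collect_eq prod.case simp_thms)
  also have "\<dots> \<longleftrightarrow> (\<exists>g. (D, V) \<in> ballot_pairs n g \<and> g + of_bool v = h + of_bool d \<and> (d \<longrightarrow> g > 0))"
    unfolding ballot_pairs_def mem_Collect_eq prod.case split0
    using D V by (auto intro!: exI[of _ "card V - card D"])
  finally show ?thesis .
qed

text \<open>
  The pairs with final height 0 have only two predecessors: if \<open>n + 1\<close> is in V alone, the height
  before it would be negative, and if it is in both sets, it would be taken into D at height 0.
\<close>

lemma card_ballot_pairs_Suc:
  "card (ballot_pairs (Suc n) 0) = card (ballot_pairs n 0) + card (ballot_pairs n 1)"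
  "card (ballot_pairs (Suc n) (Suc h)) =
     card (ballot_pairs n h) + 2 * card (ballot_pairs n (Suc h)) + card (ballot_pairs n (Suc (Suc h)))"
proof -
  let ?t = "add_top (Suc n)"
  have sub: "x \<in> Pow {1..n} \<times> Pow {1..n}" if "x \<in> ballot_pairs n g" for x g
    using that by (auto simp: ballot_pairs_def)
  have decomp: "\<exists>d v y. y \<in> Pow {1..n} \<times> Pow {1..n} \<and> x = ?t d v y"
    if "x \<in> ballot_pairs (Suc n) g" for x g
  proof -
    obtain D V where x: "x = (D, V)" by (cases x)
    have "x = ?t (Suc n \<in> D) (Suc n \<in> V) (D - {Suc n}, V - {Suc n})"
      by (auto simp: x add_top_def)
    moreover have "D - {Suc n} \<subseteq> {1..n}" "V - {Suc n} \<subseteq> {1..n}"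
      using that by (auto simp: x ballot_pairs_def le_Suc_eq)
    ultimately show ?thesis by blast
  qed
  have inj: "d = d' \<and> v = v' \<and> y = y'"
    if "?t d v y = ?t d' v' y'" "y \<in> Pow {1..n} \<times> Pow {1..n}" "y' \<in> Pow {1..n} \<times> Pow {1..n}"
    for d d' v v' y y'
  proof -
    obtain D V D' V' where y: "y = (D, V)" "y' = (D', V')" by (cases y, cases y')
    have top: "Suc n \<notin> D" "Suc n \<notin> V" "Suc n \<notin> D'" "Suc n \<notin> V'" using that y by auto
    show ?thesis
      using that(1) top by (cases d; cases v; cases d'; cases v') (auto simp: y add_top_def insert_ident)
  qed
  have card_im: "card (?t d v ` ballot_pairs n g) = card (ballot_pairs n g)" for d v g
    by (rule card_image) (use inj sub in \<open>blast intro: inj_onI\<close>)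
  have disj: "?t d v ` ballot_pairs n g \<inter> ?t d' v' ` ballot_pairs n g' = {}"
    if "d \<noteq> d' \<or> v \<noteq> v'" for d v g d' v' g'
    using inj sub that by blast
  have mem: "?t d v y \<in> ballot_pairs (Suc n) h \<longleftrightarrow>
      (\<exists>g. y \<in> ballot_pairs n g \<and> g + of_bool v = h + of_bool d \<and> (d \<longrightarrow> g > 0))"
    if "y \<in> Pow {1..n} \<times> Pow {1..n}" for d v y h
    using that add_top_in_ballot_pairs_iff[of "fst y" n "snd y" d v h] by auto
  have image: "?t d v ` ballot_pairs n g \<subseteq> ballot_pairs (Suc n) h"
    if "g + of_bool v = h + of_bool d" "d \<longrightarrow> g > 0" for d v g h
    using mem sub that by blast
  have fin: "finite (?t d v ` ballot_pairs n g)" for d v g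
    by (simp add: finite_ballot_pairs)
  have "ballot_pairs (Suc n) 0 = ?t False False ` ballot_pairs n 0 \<union> ?t True False ` ballot_pairs n 1"
    (is "_ = ?U")
  proof
    show "ballot_pairs (Suc n) 0 \<subseteq> ?U"
    proof
      fix x assume x: "x \<in> ballot_pairs (Suc n) 0"
      then obtain d v y where y: "y \<in> Pow {1..n} \<times> Pow {1..n}" "x = ?t d v y" using decomp by blast
      then obtain g where "y \<in> ballot_pairs n g" "g + of_bool v = of_bool d" "d \<longrightarrow> g > 0"
        using x mem[of y d v 0] by auto
      with y show "x \<in> ?U" by (cases d; cases v) auto
    qed
    show "?U \<subseteq> ballot_pairs (Suc n) 0"
      using image[of 0 False 0 False] image[of 1 False 0 True] by simp
  qed
  then show "card (ballot_pairs (Suc n) 0) = card (ballot_pairs n 0) + card (ballot_pairs n 1)"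
    by (simp add: card_Un_disjoint fin disj card_im)
  have "ballot_pairs (Suc n) (Suc h) =
      (?t False True ` ballot_pairs n h \<union> ?t False False ` ballot_pairs n (Suc h)) \<union>
      (?t True True ` ballot_pairs n (Suc h) \<union> ?t True False ` ballot_pairs n (Suc (Suc h)))"
    (is "_ = ?U")
  proof
    show "ballot_pairs (Suc n) (Suc h) \<subseteq> ?U"
    proof
      fix x assume x: "x \<in> ballot_pairs (Suc n) (Suc h)"
      then obtain d v y where y: "y \<in> Pow {1..n} \<times> Pow {1..n}" "x = ?t d v y" using decomp by blast
      then obtain g where "y \<in> ballot_pairs n g" "g + of_bool v = Suc h + of_bool d"
        using x mem[of y d v "Suc h"] by auto
      with y show "x \<in> ?U" by (cases d; cases v) auto
    qed
    show "?U \<subseteq> ballot_pairs (Suc n) (Suc h)"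
      using image[of h True "Suc h" False] image[of "Suc h" False "Suc h" False]
        image[of "Suc h" True "Suc h" True] image[of "Suc (Suc h)" False "Suc h" True] by simp
  qed
  then show "card (ballot_pairs (Suc n) (Suc h)) =
     card (ballot_pairs n h) + 2 * card (ballot_pairs n (Suc h)) + card (ballot_pairs n (Suc (Suc h)))"
    by (simp add: card_Un_disjoint fin disj card_im Int_Un_distrib Int_Un_distrib2)
qed

text \<open>
  This is the reflection principle's count of nonnegative paths with \<open>2 * n\<close> steps from height 0
  to height \<open>2 * h\<close>.
\<close>

lemma card_ballot_pairs:
  "real (card (ballot_pairs n h)) = real ((2 * n) choose (n + h)) - real ((2 * n) choose (n + h + 1))"
proof (induction n arbitrary: h)
  case 0
  have "ballot_pairs 0 h = (if h = 0 then {({}, {})} else {})"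
    by (auto simp: ballot_pairs_def)
  then show ?case by simp
next
  case (Suc n)
  show ?case
  proof (cases h)
    case 0
    have "(2 * n + 1) choose n = (2 * n + 1) choose (n + 1)"
      by (subst binomial_symmetric) auto
    then have "(2 * Suc n) choose (Suc n) = 2 * (((2 * n) choose n) + ((2 * n) choose (n + 1)))"
      by simp
    moreover have "(2 * Suc n) choose (Suc n + 1) =
        ((2 * n) choose n) + 2 * ((2 * n) choose (n + 1)) + ((2 * n) choose (n + 2))"
      by (simp add: numeral_2_eq_2)
    ultimately show ?thesis
      using Suc.IH[of 0] Suc.IH[of 1] by (simp add: 0 card_ballot_pairs_Suc(1))
  next
    case (Suc k)
    have "(2 * Suc n) choose (Suc n + Suc k + i) =
        ((2 * n) choose (n + k + i)) + 2 * ((2 * n) choose (n + k + i + 1)) +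
        ((2 * n) choose (n + k + i + 2))" for i
      by (simp add: numeral_2_eq_2)
    from this[of 0] this[of 1] show ?thesis
      using Suc.IH[of k] Suc.IH[of "Suc k"] Suc.IH[of "Suc (Suc k)"]
      by (simp add: Suc card_ballot_pairs_Suc(2))
  qed
qed

lemma catalan_eq_binomial_diff:
  "catalan n = real ((2 * n) choose n) - real ((2 * n) choose (n + 1))"
proof -
  have "Suc n * ((2 * n) choose Suc n) = n * ((2 * n) choose n)"
    using binomial_absorb_comp[of "2 * n" n] binomial_absorption[of n "2 * n"]
    by (metis diff_add_inverse mult_2)
  then have "(real n + 1) * real ((2 * n) choose (n + 1)) = real n * real ((2 * n) choose n)"
    by (metis Suc_eq_plus1 of_nat_Suc of_nat_mult add.commute)
  then show ?thesis by (simp add: catalan_def field_simps)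
qed

theorem theorem3p6:
  fixes n :: nat
  shows "card (dumont4_avoiding n [1, 4, 3, 2]) = card (dumont4_avoiding n [3, 2, 1])
    \<and> real (card (dumont4_avoiding n [3, 2, 1])) = catalan n"
proof
  show "card (dumont4_avoiding n [1, 4, 3, 2]) = card (dumont4_avoiding n [3, 2, 1])"
    by (simp only: dumont4_avoiding_1432_eq_321)
  show "real (card (dumont4_avoiding n [3, 2, 1])) = catalan n"
    using card_ballot_pairs[of n 0]
    by (simp only: card_dumont4_avoiding_321_eq_even_pairs card_even_ballot_pairs catalan_eq_binomial_diff
        add_0_right)
qed

end
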